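(* Let $C_2=[0,1]^2\subset\mathbb{R}^2$ be the unit square. For arbitrary integer weights $\mathbf{a}=(a,b)\in\mathbb{Z}^2$, the refined Ehrhart series of $C_2$ with weights $(a,b)$ is $$E^{(a,b)}_{C_2}(t,q) = \frac{1-q^{a+b}t^2}{(1-t)(1-q^{a}t)(1-q^{b}t)(1-q^{a+b}t)}.$$
   Context: For a $d$-dimensional lattice polytope $\Sigma\subset\mathbb{R}^d$ (a compact convex polytope with vertices in $\mathbb{Z}^d$) and weights $\mathbf{a}=(a_1,\ldots,a_d)\in\mathbb{Z}^d$, let $r\Sigma$ denote the $r$-fold dilation of $\Sigma$ for an integer $r\geq 0$. For integers $k$ put $L^{\mathbf{a}}_\Sigma(r,k)=\#\{\mathbf{v}\in r\Sigma\cap\mathbb{Z}^d : \mathbf{v}\cdot\mathbf{a}=k\}$, where $\cdot$ is the standard inner product. The refined Ehrhart series is $$E^{\mathbf{a}}_\Sigma(t,q)=\sum_{r=0}^\infty\sum_{k\in\mathbb{Z}}L^{\mathbf{a}}_\Sigma(r,k)\,q^kt^r,$$ a formal power series in $t$ with coefficients in the Laurent polynomials $\mathbb{Z}[q,q^{-1}]$. Rational expressions are expanded as power series in $t$ over $\mathbb{Z}[q,q^{-1}]$. *)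

theory Defs
  imports
    "HOL-Analysis.Analysis"
    "HOL-Library.Poly_Mapping"
    "HOL-Computational_Algebra.Formal_Power_Series"
begin

text \<open>
  The ring \<open>\<int>[q, q\<^sup>-\<^sup>1]\<close> is the group ring of \<open>\<int>\<close>: finitely supported
  functions from exponents to coefficients, multiplied by convolution.
\<close>

type_synonym laurent = "int \<Rightarrow>\<^sub>0 int"

definition qpow :: "int \<Rightarrow> laurent" where
  "qpow k = Poly_Mapping.single k 1"

definition lattice_points :: "(real ^ 'd) set" where
  "lattice_points = {v. \<forall>i. v $ i \<in> \<int>}"

definition dilation :: "nat \<Rightarrow> (real ^ 'd) set \<Rightarrow> (real ^ 'd) set" where
  "dilation r S = (\<lambda>x. real r *\<^sub>R x) ` S"

definition level_points :: "int ^ 'd \<Rightarrow> (real ^ 'd) set \<Rightarrow> nat \<Rightarrow> int \<Rightarrow> (real ^ 'd) set" where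
  "level_points a S r k =
     {v \<in> dilation r S \<inter> lattice_points. v \<bullet> (\<chi> i. real_of_int (a $ i)) = real_of_int k}"

definition level_count :: "int ^ 'd \<Rightarrow> (real ^ 'd) set \<Rightarrow> nat \<Rightarrow> int \<Rightarrow> nat" where
  "level_count a S r k = card (level_points a S r k)"

text \<open>
  The sum over \<open>k\<close> is restricted to nonzero terms, since the library sum is only
  meaningful on finite index sets. For bounded \<open>S\<close>, in particular for polytopes, all
  sets involved are finite; see \<open>finite_level_points\<close> and \<open>lookup_refined_ehrhart\<close> below.
\<close>

definition refined_ehrhart :: "int ^ 'd \<Rightarrow> (real ^ 'd) set \<Rightarrow> laurent fps" where
  "refined_ehrhart a S =
     Abs_fps (\<lambda>r. \<Sum>k | level_count a S r k \<noteq> 0. of_nat (level_count a S r k) * qpow k)"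

text \<open>
  Expansion of \<open>N / D\<close> as a power series, for \<open>D\<close> with constant coefficient 1. Division
  of power series is not available here because the coefficients lack an inverse operation;
  the second argument of \<open>fps_right_inverse\<close> is the inverse of the constant coefficient.
\<close>

definition fps_frac :: "laurent fps \<Rightarrow> laurent fps \<Rightarrow> laurent fps" where
  "fps_frac N D = N * fps_right_inverse D 1"

lemma fps_frac_mult:
  assumes "fps_nth D 0 = 1"
  shows "fps_frac N D * D = N"
proof -
  have "D * fps_right_inverse D 1 = 1"
    by (rule fps_right_inverse) (simp add: assms)
  then show ?thesis
    unfolding fps_frac_def by (simp add: mult.assoc mult.commute[of _ D])
qed

lemma finite_lattice_points_dilation:
  fixes S :: "(real ^ 'd) set"
  assumes "bounded S"
  shows "finite (dilation r S \<inter> lattice_points)"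
proof -
  have "bounded (dilation r S)"
    unfolding dilation_def by (rule bounded_scaling[OF assms])
  then obtain B where B: "\<And>x. x \<in> dilation r S \<Longrightarrow> norm x \<le> B"
    by (auto simp: bounded_iff)
  let ?F = "{x::real. x \<in> \<int> \<and> \<bar>x\<bar> \<le> B}"
  have "finite (vec_lambda ` (UNIV \<rightarrow>\<^sub>E ?F) :: (real ^ 'd) set)"
    by (intro finite_imageI finite_PiE finite_abs_int_segment) auto
  moreover have "dilation r S \<inter> lattice_points \<subseteq> vec_lambda ` (UNIV \<rightarrow>\<^sub>E ?F)"
  proof
    fix v assume v: "v \<in> dilation r S \<inter> lattice_points"
    have "\<bar>v $ i\<bar> \<le> B" for i
      using component_le_norm_cart[of v i] B[of v] v by simp
    then have "vec_nth v \<in> UNIV \<rightarrow>\<^sub>E ?F"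
      using v by (auto simp: lattice_points_def)
    then have "vec_lambda (vec_nth v) \<in> vec_lambda ` (UNIV \<rightarrow>\<^sub>E ?F)"
      by (rule imageI)
    then show "v \<in> vec_lambda ` (UNIV \<rightarrow>\<^sub>E ?F)"
      by simp
  qed
  ultimately show ?thesis
    by (rule rev_finite_subset)
qed

lemma finite_level_points:
  assumes "bounded S"
  shows "finite (level_points a S r k)"
  by (rule finite_subset[OF _ finite_lattice_points_dilation[OF assms, of r]])
     (auto simp: level_points_def)

lemma finite_level_support:
  assumes "bounded S"
  shows "finite {k. level_count a S r k \<noteq> 0}"
proof (rule finite_subset)
  show "{k. level_count a S r k \<noteq> 0} \<subseteq>
      (\<lambda>v. \<lfloor>v \<bullet> (\<chi> i. real_of_int (a $ i))\<rfloor>) ` (dilation r S \<inter> lattice_points)"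
  proof
    fix k assume "k \<in> {k. level_count a S r k \<noteq> 0}"
    then have "level_points a S r k \<noteq> {}"
      by (auto simp: level_count_def)
    then show "k \<in> (\<lambda>v. \<lfloor>v \<bullet> (\<chi> i. real_of_int (a $ i))\<rfloor>) ` (dilation r S \<inter> lattice_points)"
      by (auto simp: level_points_def intro!: rev_image_eqI)
  qed
qed (intro finite_imageI finite_lattice_points_dilation assms)

lemma of_nat_mult_qpow: "of_nat n * qpow k = Poly_Mapping.single k (int n)"
  using mult_single[of 0 "int n" k 1] by (simp add: qpow_def)

lemma lookup_refined_ehrhart:
  assumes "bounded S"
  shows "Poly_Mapping.lookup (fps_nth (refined_ehrhart a S) r) k = int (level_count a S r k)"
  using finite_level_support[OF assms, of a r]
  by (simp add: refined_ehrhart_def of_nat_mult_qpow lookup_sum lookup_single when_def)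

end

theory Submission
  imports Defs
begin

text \<open>
  The lattice points of the dilated square are the pairs \<open>(i, j)\<close> with \<open>0 \<le> i, j \<le> r\<close>, so with
  \<open>x = q\<^sup>a\<close> and \<open>y = q\<^sup>b\<close> the coefficient of \<open>t\<^sup>r\<close> factors as \<open>A\<^sub>r B\<^sub>r\<close>, where
  \<open>A\<^sub>r = 1 + x + \<dots> + x\<^sup>r\<close> and \<open>B\<^sub>r = 1 + y + \<dots> + y\<^sup>r\<close>
  (\<open>nth_refined_ehrhart\<close>, \<open>lattice_points_dilated_square\<close>).

  It remains to sum \<open>A\<^sub>r B\<^sub>r t\<^sup>r\<close>, which works over any commutative ring. Substituting
  \<open>A\<^sub>r = 1 + x A\<^sub>r\<^sub>-\<^sub>1\<close> and \<open>B\<^sub>r = 1 + y B\<^sub>r\<^sub>-\<^sub>1\<close> cancels the product terms: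
  with \<open>A\<^sub>-\<^sub>1 = B\<^sub>-\<^sub>1 = 0\<close>, \<open>A\<^sub>r B\<^sub>r - x y A\<^sub>r\<^sub>-\<^sub>1 B\<^sub>r\<^sub>-\<^sub>1 = A\<^sub>r + B\<^sub>r - 1\<close>.
  Hence multiplying the series by \<open>1 - x y t\<close> leaves
  \<open>1 / ((1 - t) (1 - x t)) + 1 / ((1 - t) (1 - y t)) - 1 / (1 - t)\<close>, and clearing the
  denominators gives the numerator \<open>(1 - y t) + (1 - x t) - (1 - x t) (1 - y t) = 1 - x y t\<^sup>2\<close>
  (\<open>fps_geometric_sum_product\<close>).
\<close>

lemma one_minus_const_X_mult_Abs_fps:
  fixes c :: "'a::comm_ring_1"
  shows "(1 - fps_const c * fps_X) * Abs_fps f =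
    Abs_fps (\<lambda>n. case n of 0 \<Rightarrow> f 0 | Suc m \<Rightarrow> f (Suc m) - c * f m)"
  by (rule fps_ext) (simp add: algebra_simps mult.assoc split: nat.split)

lemma fps_geometric:
  "(1 - fps_X) * Abs_fps (\<lambda>_. 1) = (1 :: 'a::comm_ring_1 fps)"
proof -
  have "(1 - fps_X) * Abs_fps (\<lambda>_. 1 :: 'a) = (1 - fps_const 1 * fps_X) * Abs_fps (\<lambda>_. 1)"
    by simp
  also have "\<dots> = 1"
    unfolding one_minus_const_X_mult_Abs_fps by (rule fps_ext) (simp split: nat.split)
  finally show ?thesis .
qed

lemma fps_geometric_sum:
  fixes c :: "'a::comm_ring_1"
  shows "(1 - fps_const c * fps_X) * Abs_fps (\<lambda>n. \<Sum>i\<le>n. c ^ i) = Abs_fps (\<lambda>_. 1)"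
  unfolding one_minus_const_X_mult_Abs_fps
  by (rule fps_ext) (simp add: sum.atMost_Suc_shift sum_distrib_left del: sum.atMost_Suc split: nat.split)

lemma fps_geometric_sum_product:
  fixes x y :: "'a::comm_ring_1"
  shows "Abs_fps (\<lambda>n. (\<Sum>i\<le>n. x ^ i) * (\<Sum>j\<le>n. y ^ j)) *
      ((1 - fps_X) * (1 - fps_const x * fps_X) * (1 - fps_const y * fps_X)
        * (1 - fps_const (x * y) * fps_X)) =
    1 - fps_const (x * y) * fps_X ^ 2"
proof -
  define A where "A = Abs_fps (\<lambda>n. \<Sum>i\<le>n. x ^ i)"
  define B where "B = Abs_fps (\<lambda>n. \<Sum>j\<le>n. y ^ j)"
  define C where "C = Abs_fps (\<lambda>n. (\<Sum>i\<le>n. x ^ i) * (\<Sum>j\<le>n. y ^ j))"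
  define G :: "'a fps" where "G = Abs_fps (\<lambda>_. 1)"
  define u where "u = 1 - fps_const x * fps_X"
  define v where "v = 1 - fps_const y * fps_X"
  have C: "(1 - fps_const (x * y) * fps_X) * C = A + B - G"
  proof (rule fps_ext)
    fix n
    have step: "(\<Sum>i\<le>Suc m. c ^ i) = 1 + c * (\<Sum>i\<le>m. c ^ i)" for c :: 'a and m
      by (simp add: sum.atMost_Suc_shift sum_distrib_left del: sum.atMost_Suc)
    show "fps_nth ((1 - fps_const (x * y) * fps_X) * C) n = fps_nth (A + B - G) n"
      unfolding C_def one_minus_const_X_mult_Abs_fps
      by (simp add: A_def B_def G_def step algebra_simps del: sum.atMost_Suc split: nat.split)
  qed
  have A: "u * A = G" and B: "v * B = G" and G: "(1 - fps_X) * G = 1"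
    by (simp_all add: u_def v_def A_def B_def G_def fps_geometric_sum fps_geometric)
  have "C * ((1 - fps_X) * u * v * (1 - fps_const (x * y) * fps_X))
      = (1 - fps_X) * u * v * ((1 - fps_const (x * y) * fps_X) * C)"
    by (simp add: mult_ac)
  also have "\<dots> = (1 - fps_X) * (v * (u * A) + u * (v * B) - u * v * G)"
    unfolding C by (simp add: algebra_simps)
  also have "\<dots> = ((1 - fps_X) * G) * (v + u - u * v)"
    unfolding A B by (simp add: algebra_simps)
  also have "\<dots> = 1 - fps_const (x * y) * fps_X ^ 2"
    unfolding G u_def v_def
    by (simp add: algebra_simps power2_eq_square flip: fps_const_mult)
  finally show ?thesis
    unfolding C_def u_def v_def .
qed

lemma fps_frac_unique:
  assumes "fps_nth D 0 = 1" "F * D = N"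
  shows "F = fps_frac N D"
proof -
  have "D * fps_right_inverse D 1 = 1"
    by (rule fps_right_inverse) (simp add: assms(1))
  then show ?thesis
    by (simp add: fps_frac_def mult.assoc flip: assms(2))
qed

lemma qpow_add: "qpow (k + l) = qpow k * qpow l"
  by (simp add: qpow_def mult_single)

lemma qpow_mult_nat: "qpow (k * int n) = qpow k ^ n"
proof (induction n)
  case 0
  show ?case by (simp add: qpow_def)
next
  case (Suc n)
  then show ?case by (simp add: distrib_left qpow_add)
qed

text \<open>
  Summing over the lattice points themselves, rather than over their levels, lets a product
  structure of the point set carry over to the coefficient. The floor only converts the real inner product to its integer value: on lattice
  points, this product is an integer.
\<close>

lemma nth_refined_ehrhart:
  fixes S :: "(real ^ 'd) set"
  assumes "bounded S"
  shows "fps_nth (refined_ehrhart a S) r =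
    (\<Sum>v\<in>dilation r S \<inter> lattice_points. qpow \<lfloor>v \<bullet> (\<chi> i. real_of_int (a $ i))\<rfloor>)"
proof -
  define P where "P = dilation r S \<inter> lattice_points"
  define w where "w v = v \<bullet> (\<chi> i. real_of_int (a $ i))" for v
  define K where "K = {k. level_count a S r k \<noteq> 0}"
  have "w v \<in> \<int>" if "v \<in> P" for v
    using that unfolding w_def inner_vec_def P_def lattice_points_def
    by (auto intro!: Ints_sum Ints_mult)
  then have w: "w v = real_of_int k \<longleftrightarrow> \<lfloor>w v\<rfloor> = k" if "v \<in> P" for v k
    using that by (metis floor_of_int of_int_floor)
  have level: "level_points a S r k = {v \<in> P. \<lfloor>w v\<rfloor> = k}" for k
    using w by (auto simp: level_points_def P_def w_def)
  have fin: "finite P"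
    unfolding P_def by (rule finite_lattice_points_dilation[OF assms])
  have "\<lfloor>w v\<rfloor> \<in> K" if "v \<in> P" for v
    using that fin by (auto simp: K_def level_count_def level)
  then have "(\<Sum>k\<in>K. \<Sum>v | v \<in> P \<and> \<lfloor>w v\<rfloor> = k. qpow \<lfloor>w v\<rfloor>) = (\<Sum>v\<in>P. qpow \<lfloor>w v\<rfloor>)"
    using finite_level_support[OF assms, of a r]
    by (intro sum.group fin) (auto simp: K_def)
  moreover have "(\<Sum>v | v \<in> P \<and> \<lfloor>w v\<rfloor> = k. qpow \<lfloor>w v\<rfloor>) =
      of_nat (level_count a S r k) * qpow k" for k
    by (simp add: level_count_def level)
  ultimately have "(\<Sum>k\<in>K. of_nat (level_count a S r k) * qpow k) = (\<Sum>v\<in>P. qpow \<lfloor>w v\<rfloor>)"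
    by (simp only:)
  then show ?thesis
    by (simp add: refined_ehrhart_def K_def P_def w_def)
qed

lemma lattice_points_dilated_square:
  "dilation r (cbox 0 1) \<inter> lattice_points =
    (\<lambda>(i, j). vector [real i, real j] :: real ^ 2) ` ({..r} \<times> {..r})"
proof (intro set_eqI iffI)
  fix v :: "real ^ 2"
  assume "v \<in> dilation r (cbox 0 1) \<inter> lattice_points"
  then have v: "0 \<le> v $ i" "v $ i \<le> real r" "v $ i \<in> \<int>" for i
    by (auto simp: dilation_def lattice_points_def mem_box_cart mult_left_le)
  have nat: "v $ i = real (nat \<lfloor>v $ i\<rfloor>)" "nat \<lfloor>v $ i\<rfloor> \<le> r" for i
    using v[of i] by (auto elim!: Ints_cases)
  have "v = vector [real (nat \<lfloor>v $ 1\<rfloor>), real (nat \<lfloor>v $ 2\<rfloor>)]"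
    using nat(1) by (simp add: vec_eq_iff forall_2)
  then show "v \<in> (\<lambda>(i, j). vector [real i, real j]) ` ({..r} \<times> {..r})"
    using nat(2) by (auto intro!: image_eqI[where x = "(nat \<lfloor>v $ 1\<rfloor>, nat \<lfloor>v $ 2\<rfloor>)"])
next
  fix v :: "real ^ 2"
  assume "v \<in> (\<lambda>(i, j). vector [real i, real j]) ` ({..r} \<times> {..r})"
  then obtain i j where v: "v = vector [real i, real j]" and ij: "i \<le> r" "j \<le> r"
    by auto
  \<comment> \<open>For \<open>r = 0\<close> the division by \<open>r\<close> yields \<open>0\<close>, and the origin is a preimage of itself.\<close>
  have "v = real r *\<^sub>R vector [real i / real r, real j / real r]"
    using ij by (simp add: v vec_eq_iff forall_2)
  moreover have "vector [real i / real r, real j / real r] \<in> cbox 0 (1 :: real ^ 2)"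
    using ij by (auto simp: mem_box_cart forall_2 divide_le_eq_1)
  ultimately show "v \<in> dilation r (cbox 0 1) \<inter> lattice_points"
    by (auto simp: dilation_def lattice_points_def v forall_2)
qed

lemma nth_refined_ehrhart_square:
  "fps_nth (refined_ehrhart (vector [a, b] :: int ^ 2) (cbox 0 1)) r =
    (\<Sum>i\<le>r. qpow a ^ i) * (\<Sum>j\<le>r. qpow b ^ j)"
proof -
  define w :: "real ^ 2 \<Rightarrow> int"
    where "w v = \<lfloor>v \<bullet> (\<chi> i. real_of_int ((vector [a, b] :: int ^ 2) $ i))\<rfloor>" for v
  have inj: "inj_on (\<lambda>(i, j). vector [real i, real j] :: real ^ 2) ({..r} \<times> {..r})"
    by (auto simp: inj_on_def vec_eq_iff forall_2)
  have w: "w (vector [real i, real j]) = a * int i + b * int j" for i j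
  proof -
    have "vector [real i, real j] \<bullet> (\<chi> i. real_of_int ((vector [a, b] :: int ^ 2) $ i))
        = real_of_int (a * int i + b * int j)"
      by (simp add: inner_vec_def sum_2 mult.commute)
    then show ?thesis
      unfolding w_def by (simp only: floor_of_int)
  qed
  have "fps_nth (refined_ehrhart (vector [a, b] :: int ^ 2) (cbox 0 1)) r =
      (\<Sum>v\<in>(\<lambda>(i, j). vector [real i, real j]) ` ({..r} \<times> {..r}). qpow (w v))"
    by (simp add: nth_refined_ehrhart lattice_points_dilated_square w_def)
  also have "\<dots> = (\<Sum>(i, j)\<in>{..r} \<times> {..r}. qpow a ^ i * qpow b ^ j)"
    unfolding sum.reindex[OF inj]
    by (intro sum.cong) (auto simp: w qpow_add qpow_mult_nat)
  also have "\<dots> = (\<Sum>i\<le>r. qpow a ^ i) * (\<Sum>j\<le>r. qpow b ^ j)"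
    by (simp add: sum_product sum.cartesian_product)
  finally show ?thesis .
qed

theorem proposition2p3:
  fixes a b :: int
  shows "refined_ehrhart (vector [a, b] :: int ^ 2) (cbox 0 1) =
    fps_frac
      (1 - fps_const (qpow (a + b)) * fps_X ^ 2)
      ((1 - fps_X) * (1 - fps_const (qpow a) * fps_X) * (1 - fps_const (qpow b) * fps_X)
        * (1 - fps_const (qpow (a + b)) * fps_X))"
proof (rule fps_frac_unique)
  have "refined_ehrhart (vector [a, b] :: int ^ 2) (cbox 0 1) =
      Abs_fps (\<lambda>r. (\<Sum>i\<le>r. qpow a ^ i) * (\<Sum>j\<le>r. qpow b ^ j))"
    by (rule fps_ext) (simp add: nth_refined_ehrhart_square)
  then show "refined_ehrhart (vector [a, b] :: int ^ 2) (cbox 0 1) *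
      ((1 - fps_X) * (1 - fps_const (qpow a) * fps_X) * (1 - fps_const (qpow b) * fps_X)
        * (1 - fps_const (qpow (a + b)) * fps_X)) =
      1 - fps_const (qpow (a + b)) * fps_X ^ 2"
    unfolding qpow_add by (simp only: fps_geometric_sum_product)
qed simp

end
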